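(* Let $D$ be the generator of a strongly continuous one-parameter group of isometries $e^{tD}$, $t\in\mathbb{R}$, in a complex Banach space $E$. Then the set $\bigcup_{\sigma\ge 0}\mathbf{B}_\sigma(D)$ is dense in $E$.
   Context: $\mathcal{D}^k$ denotes the domain of $D^k$ and $\mathcal{D}^\infty=\bigcap_{k\in\mathbb{N}}\mathcal{D}^k$. For $\sigma\ge 0$, the Bernstein subspace $\mathbf{B}_\sigma(D)$ is the set of all $f\in\mathcal{D}^\infty$ such that $\|D^kf\|\le\sigma^k\|f\|$ for all $k\in\mathbb{N}=\{1,2,\dots\}$. *)

theory Defs
  imports "HOL-Analysis.Analysis"
begin

section \<open>Complex Banach spaces\<close>

text \<open>HOL-Analysis only provides real normed spaces. A complex Banach space is a real one with a
  complex scalar multiplication that extends the real one and for which the norm is absolutely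
  homogeneous.\<close>

class complex_banach = banach +
  fixes scaleC :: "complex \<Rightarrow> 'a \<Rightarrow> 'a"  (infixr "*\<^sub>C" 75)
  assumes scaleC_add_right: "c *\<^sub>C (x + y) = c *\<^sub>C x + c *\<^sub>C y"
    and scaleC_add_left: "(c + d) *\<^sub>C x = c *\<^sub>C x + d *\<^sub>C x"
    and scaleC_scaleC: "c *\<^sub>C (d *\<^sub>C x) = (c * d) *\<^sub>C x"
    and scaleC_of_real: "complex_of_real r *\<^sub>C x = r *\<^sub>R x"
    and norm_scaleC: "norm (c *\<^sub>C x) = cmod c * norm x"

lemma vector_space_scaleC:
  "vector_space (scaleC :: complex \<Rightarrow> 'a :: complex_banach \<Rightarrow> 'a)"
proof
  show "1 *\<^sub>C x = x" for x :: 'a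
    using scaleC_of_real[of 1 x] by simp
qed (simp_all add: scaleC_add_right scaleC_add_left scaleC_scaleC)

instantiation complex :: complex_banach
begin

definition scaleC_complex :: "complex \<Rightarrow> complex \<Rightarrow> complex" where
  "scaleC_complex = (*)"

instance
  by standard (simp_all add: scaleC_complex_def algebra_simps norm_mult scaleR_conv_of_real)

end


section \<open>One-parameter groups of isometries and their generators\<close>

locale isometry_group =
  fixes T :: "real \<Rightarrow> 'a :: complex_banach \<Rightarrow> 'a"
  assumes linear: "Vector_Spaces.linear scaleC scaleC (T t)"
    and zero: "T 0 = id"
    and add: "T (s + t) = T s \<circ> T t"
    and isometry: "norm (T t x) = norm x"
    and strongly_continuous: "continuous_on UNIV (\<lambda>t. T t x)"

text \<open>An operator in \<open>E\<close>, in general not everywhere defined, is a partial map \<open>D\<close>;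
  its domain is \<open>dom D\<close>. For a one-parameter group the difference quotients
  are taken with \<open>t\<close> tending to 0 from both sides.\<close>

definition generator :: "(real \<Rightarrow> 'a :: complex_banach \<Rightarrow> 'a) \<Rightarrow> 'a \<rightharpoonup> 'a" where
  "generator T = (\<lambda>x.
     if \<exists>y. ((\<lambda>t. (T t x - x) /\<^sub>R t) \<longlongrightarrow> y) (at 0)
     then Some (Lim (at 0) (\<lambda>t. (T t x - x) /\<^sub>R t))
     else None)"

lemma generator_eq_Some_iff:
  "generator T x = Some y \<longleftrightarrow> ((\<lambda>t. (T t x - x) /\<^sub>R t) \<longlongrightarrow> y) (at 0)"
  by (auto simp: generator_def intro: tendsto_Lim dest: tendsto_Lim[OF at_neq_bot])


section \<open>Bernstein subspaces\<close>

text \<open>Since \<open>(\<circ>\<^sub>m)\<close> is composition of partial maps, \<open>dom (op_power D k)\<close> is the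
  natural domain of the \<open>k\<close>-th power of \<open>D\<close>.\<close>

primrec op_power :: "('a \<rightharpoonup> 'a) \<Rightarrow> nat \<Rightarrow> ('a \<rightharpoonup> 'a)" where
  "op_power D 0 = Some"
| "op_power D (Suc k) = D \<circ>\<^sub>m op_power D k"

definition smooth_domain :: "('a \<rightharpoonup> 'a) \<Rightarrow> 'a set" where
  "smooth_domain D = (\<Inter>k\<in>{1..}. dom (op_power D k))"

text \<open>On \<open>smooth_domain D\<close> the values \<open>op_power D k f\<close> with \<open>k \<ge> 1\<close> are never \<open>None\<close>,
  so \<open>the\<close> is applied to defined values only.\<close>

definition Bernstein_space :: "('a :: real_normed_vector \<rightharpoonup> 'a) \<Rightarrow> real \<Rightarrow> 'a set" where
  "Bernstein_space D \<sigma> =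
     {f \<in> smooth_domain D. \<forall>k\<ge>1. norm (the (op_power D k f)) \<le> \<sigma> ^ k * norm f}"

end

theory Submission
  imports Defs "HOL-Probability.Sinc_Integral"
begin

text \<open>Regularise \<open>f\<close> by averaging its orbit against the band-limited, integrable kernel
  \<open>h t = (1 - cos t) / t\<^sup>2\<close>: the vectors \<open>\<integral> h u T(\<epsilon> u) f du / \<integral> h\<close> tend to \<open>f\<close> as \<open>\<epsilon> \<rightarrow> 0\<close>, and
  \<open>D\<close> acts on such averages by replacing \<open>h\<close> with \<open>- h' / \<epsilon>\<close>. All derivatives of \<open>h\<close> decay like
  \<open>1 / (1 + t\<^sup>2)\<close> with constants growing geometrically in the order of the derivative, so every
  average \<open>g\<close> satisfies \<open>\<parallel>D\<^sup>k g\<parallel> \<le> C s\<^sup>k\<close> for all \<open>k\<close>.\<close>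

section \<open>Integration over the line and kernels of quadratic decay\<close>

text \<open>A box containing the ball of radius \<open>B + norm c\<close> still contains the ball of
  radius \<open>B\<close> after translation by \<open>c\<close>, so the limit over boxes carries
  over.\<close>

lemma has_integral_UNIV_shift:
  fixes f :: "'n::euclidean_space \<Rightarrow> 'a::banach"
  assumes "(f has_integral i) UNIV"
  shows "((\<lambda>x. f (c + x)) has_integral i) UNIV"
  unfolding has_integral'[of _ i UNIV]
proof (intro allI impI)
  fix e :: real
  assume "e > 0"
  then obtain B where "B > 0" and B: "\<And>a b. ball 0 B \<subseteq> cbox a b \<Longrightarrow>
      \<exists>z. (f has_integral z) (cbox a b) \<and> norm (z - i) < e"
    using assms unfolding has_integral'[of _ i UNIV] by auto
  show "\<exists>B>0. \<forall>a b. ball 0 B \<subseteq> cbox a b \<longrightarrow>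
      (\<exists>z. ((\<lambda>x. if x \<in> UNIV then f (c + x) else 0) has_integral z) (cbox a b) \<and> norm (z - i) < e)"
  proof (intro exI[of _ "B + norm c"] conjI allI impI)
    show "B + norm c > 0"
      using \<open>B > 0\<close> by (simp add: add_pos_nonneg)
    fix a b :: 'n
    assume sub: "ball 0 (B + norm c) \<subseteq> cbox a b"
    have "ball 0 B \<subseteq> cbox (a + c) (b + c)"
    proof
      fix x :: 'n
      assume "x \<in> ball 0 B"
      then have "x - c \<in> ball 0 (B + norm c)"
        using norm_triangle_ineq4[of x c] by (simp add: norm_minus_commute)
      with sub have "x - c \<in> cbox a b" by blast
      then show "x \<in> cbox (a + c) (b + c)"
        by (auto simp: mem_box inner_diff_left inner_add_left algebra_simps)
    qed
    from B[OF this] show "\<exists>z. ((\<lambda>x. if x \<in> UNIV then f (c + x) else 0) has_integral z) (cbox a b)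
        \<and> norm (z - i) < e"
      unfolding has_integral_shift_cbox_iff[symmetric] by (simp add: o_def)
  qed
qed

lemma integrable_on_inverse_1_plus_square: "(\<lambda>x::real. inverse (1 + x\<^sup>2)) integrable_on UNIV"
proof -
  have "integrable lborel (\<lambda>x::real. inverse (1 + x\<^sup>2))"
    using integrable_inverse_1_plus_square by (simp add: set_integrable_def)
  then show ?thesis
    by (rule integrable_on_lborel)
qed

text \<open>Lets a bound at an intermediate point of a Taylor expansion be replaced by one at the
  base point, at the cost of a fixed factor.\<close>

lemma inverse_1_plus_square_shift_le:
  fixes t u :: real
  assumes "\<bar>u - t\<bar> \<le> 1"
  shows "inverse (1 + u\<^sup>2) \<le> 3 * inverse (1 + t\<^sup>2)"
proof -
  have "(u - t)\<^sup>2 \<le> 1"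
    using assms by (simp add: abs_square_le_1)
  \<comment> \<open>The right side minus the left side is
    \<open>(2 * u - t)\<^sup>2\<close>.\<close>
  moreover have "t\<^sup>2 \<le> 2 * u\<^sup>2 + 2 * (u - t)\<^sup>2"
    using zero_le_power2[of "2 * u - t"] by (simp add: power2_eq_square algebra_simps)
  ultimately have "1 + t\<^sup>2 \<le> 3 * (1 + u\<^sup>2)"
    using zero_le_power2[of u] by argo
  moreover have "1 + t\<^sup>2 > 0" "1 + u\<^sup>2 > 0"
    by (simp_all add: add_pos_nonneg)
  ultimately show ?thesis
    by (simp add: field_simps)
qed

text \<open>The constant is explicit because its growth with the order of the derivative determines
  the exponential type of the averages.\<close>

definition decay_kernel :: "real \<Rightarrow> (real \<Rightarrow> real) \<Rightarrow> bool" where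
  "decay_kernel C \<phi> \<longleftrightarrow>
     continuous_on UNIV \<phi> \<and> (\<forall>u. \<bar>\<phi> u\<bar> \<le> C * inverse (1 + u\<^sup>2))"

text \<open>Continuity gives integrability on boxes, and the integrable majorant
  \<open>C * M * inverse (1 + u\<^sup>2)\<close> extends it to the line.\<close>

lemma decay_kernel_integrable:
  fixes v :: "real \<Rightarrow> 'a::banach"
  assumes \<phi>: "decay_kernel C \<phi>" and v: "continuous_on UNIV v" "\<And>u. norm (v u) \<le> M"
  shows "(\<lambda>u. \<phi> u *\<^sub>R v u) integrable_on UNIV" (is ?int)
    and "norm (integral UNIV (\<lambda>u. \<phi> u *\<^sub>R v u))
           \<le> C * M * integral UNIV (\<lambda>u::real. inverse (1 + u\<^sup>2))" (is ?bound)
proof -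
  have le: "norm (\<phi> u *\<^sub>R v u) \<le> C * M * inverse (1 + u\<^sup>2)" for u
  proof -
    have "norm (\<phi> u *\<^sub>R v u) \<le> (C * inverse (1 + u\<^sup>2)) * M"
      unfolding norm_scaleR using \<phi> v(2)
      by (intro mult_mono) (auto simp: decay_kernel_def intro: order_trans[OF abs_ge_zero])
    then show ?thesis by (simp add: mult_ac)
  qed
  have g: "(\<lambda>u::real. C * M * inverse (1 + u\<^sup>2)) integrable_on UNIV"
    using integrable_on_cmult_left[OF integrable_on_inverse_1_plus_square, of "C * M"] by simp
  have cont: "continuous_on UNIV (\<lambda>u. \<phi> u *\<^sub>R v u)"
    using \<phi> v(1) by (auto simp: decay_kernel_def intro: continuous_intros)
  show ?int
  proof (rule integrable_on_all_intervals_integrable_bound[OF _ le g])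
    show "(\<lambda>u. if u \<in> UNIV then \<phi> u *\<^sub>R v u else 0) integrable_on cbox a b" for a b
      using continuous_on_subset[OF cont subset_UNIV, of "cbox a b"]
      by (simp add: integrable_continuous_interval)
  qed
  from integral_norm_bound_integral[OF this g le] show ?bound by simp
qed

text \<open>The mean value inequality is applied twice. The remainder is quadratic in
  \<open>s\<close> and keeps its decay in \<open>t\<close>, so it can be integrated against an
  orbit.\<close>

lemma decay_kernel_taylor:
  assumes d0: "\<And>t. (\<phi> has_real_derivative \<phi>' t) (at t)"
    and d1: "\<And>t. (\<phi>' has_real_derivative \<phi>'' t) (at t)"
    and \<phi>'': "decay_kernel C \<phi>''" and s: "\<bar>s\<bar> \<le> 1"
  shows "\<bar>\<phi> (t + s) - \<phi> t - s * \<phi>' t\<bar> \<le> 3 * C * s\<^sup>2 * inverse (1 + t\<^sup>2)"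
proof -
  define B where "B = 3 * C * inverse (1 + t\<^sup>2)"
  \<comment> \<open>The decay bound evaluated at the origin forces \<open>C \<ge> 0\<close>.\<close>
  have "0 \<le> C * inverse (1 + 0\<^sup>2)"
    using \<phi>'' unfolding decay_kernel_def by (meson abs_ge_zero order_trans)
  then have "C \<ge> 0" by simp
  define S where "S = cball t \<bar>s\<bar>"
  have S: "convex S" "t \<in> S" "t + s \<in> S"
    by (auto simp: S_def dist_norm)
  have bd: "\<bar>\<phi>'' u\<bar> \<le> B" if "u \<in> S" for u
  proof -
    have "\<bar>u - t\<bar> \<le> 1"
      using that s by (auto simp: S_def dist_real_def)
    from mult_left_mono[OF inverse_1_plus_square_shift_le[OF this] \<open>C \<ge> 0\<close>]
    show ?thesis
      using \<phi>'' by (auto simp: decay_kernel_def B_def mult_ac intro: order_trans)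
  qed
  have bd1: "\<bar>\<phi>' u - \<phi>' t\<bar> \<le> B * \<bar>s\<bar>" if "u \<in> S" for u
  proof -
    have "norm (\<phi>' u - \<phi>' t) \<le> B * norm (u - t)"
      using S that bd
      by (intro field_differentiable_bound[where S = S and f' = \<phi>''])
         (auto intro: has_field_derivative_at_within d1)
    also have "\<dots> \<le> B * \<bar>s\<bar>"
      using that \<open>C \<ge> 0\<close>
      by (intro mult_left_mono) (auto simp: S_def dist_real_def B_def)
    finally show ?thesis by simp
  qed
  \<comment> \<open>Subtracting the linear part leaves the derivative
    \<open>\<phi>' u - \<phi>' t\<close>, which \<open>bd1\<close> bounds by
    \<open>B * \<bar>s\<bar>\<close>; this yields the second factor
    \<open>\<bar>s\<bar>\<close>.\<close>
  have "((\<lambda>u. \<phi> u - \<phi>' t * u) has_real_derivative \<phi>' u - \<phi>' t) (at u within S)" for u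
    by (rule has_field_derivative_at_within) (auto intro!: derivative_eq_intros d0)
  from field_differentiable_bound[OF S(1) this _ S(3) S(2), of "B * \<bar>s\<bar>"] bd1
  have "\<bar>(\<phi> (t + s) - \<phi>' t * (t + s)) - (\<phi> t - \<phi>' t * t)\<bar> \<le> (B * \<bar>s\<bar>) * \<bar>s\<bar>"
    by simp
  also have "(B * \<bar>s\<bar>) * \<bar>s\<bar> = 3 * C * s\<^sup>2 * inverse (1 + t\<^sup>2)"
    by (simp add: B_def power2_eq_square)
  finally show ?thesis
    by (simp add: algebra_simps)
qed

section \<open>The derivatives of the kernel and their decay\<close>

text \<open>\<open>fejer k\<close> is the \<open>k\<close>-th derivative of \<open>(1 - cos t) / t\<^sup>2 = Re (\<Sum>n. (\<i> t)\<^sup>n / (n + 2)!)\<close>;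
  the derivatives shift the coefficients of the exponential generating series.\<close>

definition fejer_coeff :: "nat \<Rightarrow> real" where
  "fejer_coeff m = Re (\<i> ^ m) / (real (m + 1) * real (m + 2))"

definition fejer :: "nat \<Rightarrow> real \<Rightarrow> real" where
  "fejer k t = (\<Sum>n. fejer_coeff (n + k) / fact n * t ^ n)"

lemma abs_Re_i_power: "\<bar>Re (\<i> ^ m)\<bar> \<le> 1"
  using abs_Re_le_cmod[of "\<i> ^ m"] by (simp add: norm_power)

lemma abs_fejer_coeff: "\<bar>fejer_coeff m\<bar> \<le> 1"
proof -
  have "\<bar>fejer_coeff m\<bar> \<le> 1 / (real (m + 1) * real (m + 2))"
    using abs_Re_i_power[of m] unfolding fejer_coeff_def abs_divide
    by (intro frac_le) (auto simp: abs_mult)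
  also have "\<dots> \<le> 1"
    by (simp add: field_simps add_pos_nonneg)
  finally show ?thesis .
qed

lemma fejer_term_le: "norm (fejer_coeff (n + k) / fact n * t ^ n) \<le> \<bar>t\<bar> ^ n /\<^sub>R fact n"
  using mult_right_mono[OF abs_fejer_coeff[of "n + k"], of "\<bar>t\<bar> ^ n / fact n"]
  by (simp add: abs_mult power_abs field_simps)

lemma fejer_summable: "summable (\<lambda>n. fejer_coeff (n + k) / fact n * t ^ n)"
  by (rule summable_comparison_test'[OF summable_exp_generic fejer_term_le])

text \<open>All coefficients are at most 1, so the exponential series is a majorant, uniformly in
  \<open>k\<close>. This crude bound serves for \<open>\<bar>t\<bar> < 1\<close> and
  \<open>\<bar>t\<bar> < 4 * k\<close>.\<close>

lemma abs_fejer_le_exp: "\<bar>fejer k t\<bar> \<le> exp \<bar>t\<bar>"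
proof -
  have s: "summable (\<lambda>n. norm (fejer_coeff (n + k) / fact n * t ^ n))"
    by (rule summable_comparison_test'[OF summable_exp_generic[of "\<bar>t\<bar>"]])
       (use fejer_term_le in auto)
  have "norm (fejer k t) \<le> (\<Sum>n. norm (fejer_coeff (n + k) / fact n * t ^ n))"
    unfolding fejer_def by (rule summable_norm[OF s])
  also have "\<dots> \<le> (\<Sum>n. \<bar>t\<bar> ^ n /\<^sub>R fact n)"
    by (rule suminf_le[OF fejer_term_le s summable_exp_generic])
  finally show ?thesis by (simp add: exp_def)
qed

lemma has_real_derivative_fejer: "(fejer k has_real_derivative fejer (Suc k) t) (at t)"
proof -
  have "((\<lambda>t. \<Sum>n. fejer_coeff (n + k) / fact n * t ^ n) has_real_derivative
      (\<Sum>n. diffs (\<lambda>n. fejer_coeff (n + k) / fact n) n * t ^ n)) (at t)"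
    by (rule termdiffs_strong_converges_everywhere[OF fejer_summable])
  moreover have "diffs (\<lambda>n. fejer_coeff (n + k) / fact n) =
      (\<lambda>n. fejer_coeff (n + Suc k) / fact n)"
    by (auto simp: diffs_def fun_eq_iff field_simps simp del: of_nat_Suc)
  ultimately show ?thesis
    by (simp add: fejer_def[abs_def])
qed

text \<open>This is the cosine series without its first two terms: \<open>cos_coeff (n + 2)\<close>
  is \<open>- Re (\<i> ^ n) / fact (n + 2)\<close>, and \<open>fact (n + 2)\<close> is
  \<open>(n + 1) * (n + 2) * fact n\<close>.\<close>

lemma fejer_0: "t\<^sup>2 * fejer 0 t = 1 - cos t"
proof -
  have c: "(\<lambda>n. cos_coeff n * t ^ n) sums cos t"
    using cos_converges[of t] by simp
  then have "(\<lambda>n. cos_coeff (n + 2) * t ^ (n + 2)) sums (cos t - (\<Sum>n<2. cos_coeff n * t ^ n))"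
    by (rule sums_iff_shift'[of "\<lambda>n. cos_coeff n * t ^ n" 2, THEN iffD2])
  moreover have "(\<Sum>n<2. cos_coeff n * t ^ n) = 1"
    by (simp add: numeral_2_eq_2 cos_coeff_def)
  moreover have "cos_coeff (n + 2) * t ^ (n + 2) = - (t\<^sup>2 * (fejer_coeff (n + 0) / fact n * t ^ n))" for n
  proof -
    have "cos_coeff (n + 2) = - Re (\<i> ^ n) / fact (n + 2)"
      by (cases "even n") (auto simp: cos_coeff_def elim!: evenE oddE)
    then show ?thesis
      by (simp add: fejer_coeff_def power_add field_simps power2_eq_square)
  qed
  moreover have "(\<lambda>n. - (t\<^sup>2 * (fejer_coeff (n + 0) / fact n * t ^ n))) sums - (t\<^sup>2 * fejer 0 t)"
    unfolding fejer_def by (intro sums_minus sums_mult summable_sums fejer_summable)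
  ultimately have "cos t - 1 = - (t\<^sup>2 * fejer 0 t)"
    by (metis (no_types, lifting) sums_cong sums_unique2)
  then show ?thesis by simp
qed

text \<open>The \<open>k\<close>-th derivative of the identity \<open>fejer_0\<close>, by the Leibniz rule. For \<open>k \<le> 1\<close>
  the truncated indices \<open>k - 1\<close> and \<open>k - 2\<close> come with coefficient 0.\<close>

lemma fejer_leibniz:
  "t\<^sup>2 * fejer k t + 2 * real k * t * fejer (k - 1) t + real k * (real k - 1) * fejer (k - 2) t
     = (if k = 0 then 1 else 0) - cos (t + real k * pi / 2)"
proof (induction k arbitrary: t)
  case 0
  then show ?case by (simp add: fejer_0)
next
  case (Suc k)
  let ?F = "\<lambda>t. t\<^sup>2 * fejer k t + 2 * real k * t * fejer (k - 1) t
      + real k * (real k - 1) * fejer (k - 2) t"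
  have 1: "real k * fejer (Suc (k - 1)) t = real k * fejer k t"
    by (cases k) auto
  have 2: "real k * (real k - 1) * fejer (Suc (k - 2)) t = real k * (real k - 1) * fejer (k - 1) t"
    by (cases "k \<ge> 2") (auto simp: numeral_2_eq_2 Suc_diff_Suc not_le less_Suc_eq)
  have F: "(?F has_real_derivative 2 * t * fejer k t + t\<^sup>2 * fejer (Suc k) t
      + (2 * real k * fejer (k - 1) t + 2 * t * (real k * fejer (Suc (k - 1)) t))
      + real k * (real k - 1) * fejer (Suc (k - 2)) t) (at t)"
    by (auto intro!: derivative_eq_intros has_real_derivative_fejer)
  \<comment> \<open>The induction hypothesis holds for every \<open>t\<close>, so both of its sides
    can be differentiated and the derivatives compared.\<close>
  have F_eq: "?F = (\<lambda>t. (if k = 0 then 1 else 0) - cos (t + real k * pi / 2))"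
    using Suc.IH by (rule ext)
  have "(?F has_real_derivative sin (t + real k * pi / 2)) (at t)"
    unfolding F_eq by (auto intro!: derivative_eq_intros)
  from DERIV_unique[OF F this]
  have "2 * t * fejer k t + t\<^sup>2 * fejer (Suc k) t
      + (2 * real k * fejer (k - 1) t + 2 * t * (real k * fejer (Suc (k - 1)) t))
      + real k * (real k - 1) * fejer (Suc (k - 2)) t = sin (t + real k * pi / 2)" .
  moreover have "cos (t + real (Suc k) * pi / 2) = - sin (t + real k * pi / 2)"
  proof -
    have "t + real (Suc k) * pi / 2 = (t + real k * pi / 2) + pi / 2"
      by (simp add: field_simps)
    then show ?thesis by (simp only: cos_add cos_pi_half sin_pi_half)
  qed
  ultimately show ?case
    unfolding 1 2 by (simp add: algebra_simps)
qed

text \<open>Strong induction through \<open>fejer_leibniz\<close>, solved for its leading term. For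
  \<open>\<bar>t\<bar> \<ge> 4 * k\<close> the two lower terms contribute at most 4 and 1 and the
  cosine at most 1, so the bound 8 reproduces itself.\<close>

lemma fejer_far:
  assumes "4 * real k \<le> \<bar>t\<bar>"
  shows "t\<^sup>2 * \<bar>fejer k t\<bar> \<le> 8"
  using assms
proof (induction k rule: less_induct)
  case (less k)
  show ?case
  proof (cases "k = 0")
    case True
    have "t\<^sup>2 * \<bar>fejer 0 t\<bar> = \<bar>1 - cos t\<bar>"
      unfolding fejer_0[symmetric] by (simp add: abs_mult)
    also have "\<dots> \<le> 8"
      using cos_ge_minus_one[of t] cos_le_one[of t] by linarith
    finally show ?thesis using True by simp
  next
    case False
    define a where "a = t\<^sup>2 * \<bar>fejer (k - 1) t\<bar>"
    define b where "b = t\<^sup>2 * \<bar>fejer (k - 2) t\<bar>"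
    have t: "\<bar>t\<bar> > 0" using False less.prems by auto
    have "a \<le> 8" unfolding a_def using False less.prems by (intro less.IH) auto
    have "b \<le> 8" unfolding b_def using False less.prems by (intro less.IH) auto
    have "\<bar>2 * real k * t * fejer (k - 1) t\<bar> \<le> 4"
    proof -
      have "\<bar>2 * real k * t * fejer (k - 1) t\<bar> = 2 * real k / \<bar>t\<bar> * a"
      proof -
        have "2 * real k * s * F = 2 * real k / s * (s\<^sup>2 * F)" if "s > 0" for s F :: real
          using that by (simp add: power2_eq_square)
        from this[OF t] show ?thesis by (simp add: a_def abs_mult)
      qed
      \<comment> \<open>The assumption \<open>4 * k \<le> \<bar>t\<bar>\<close> says exactly that
        \<open>2 * k / \<bar>t\<bar> \<le> 1 / 2\<close>.\<close>
      also have "\<dots> \<le> 1 / 2 * 8"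
        using less.prems t \<open>a \<le> 8\<close> by (intro mult_mono) (auto simp: field_simps a_def)
      finally show ?thesis by simp
    qed
    moreover have "\<bar>real k * (real k - 1) * fejer (k - 2) t\<bar> \<le> 1"
    proof -
      have "\<bar>real k * (real k - 1) * fejer (k - 2) t\<bar> = (real k * (real k - 1)) / t\<^sup>2 * b"
        using t False by (simp add: b_def abs_mult)
      also have "\<dots> \<le> 1 / 8 * 8"
      proof (intro mult_mono \<open>b \<le> 8\<close>)
        have "(4 * real k)\<^sup>2 \<le> t\<^sup>2"
          using less.prems by (intro abs_le_square_iff[THEN iffD1]) simp
        then have "16 * (real k)\<^sup>2 \<le> t\<^sup>2"
          by (simp add: power_mult_distrib)
        moreover have "8 * (real k * (real k - 1)) \<le> 16 * (real k)\<^sup>2"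
        proof -
          have "0 \<le> 8 * real k * (real k + 1)" by simp
          then show ?thesis by (simp add: power2_eq_square algebra_simps)
        qed
        ultimately have "8 * (real k * (real k - 1)) \<le> t\<^sup>2"
          by (rule order_trans[rotated])
        then show "real k * (real k - 1) / t\<^sup>2 \<le> 1 / 8"
          using t by (simp add: pos_divide_le_eq del: of_nat_diff)
      qed (auto simp: b_def)
      finally show ?thesis by simp
    qed
    moreover have "t\<^sup>2 * fejer k t + 2 * real k * t * fejer (k - 1) t
        + real k * (real k - 1) * fejer (k - 2) t = - cos (t + real k * pi / 2)"
      using fejer_leibniz[of t k] False by simp
    ultimately have "\<bar>t\<^sup>2 * fejer k t\<bar> \<le> 8"
      using abs_cos_le_one[of "t + real k * pi / 2"] by linarith
    then show ?thesis by (simp add: abs_mult)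
  qed
qed

text \<open>For \<open>\<bar>t\<bar> \<ge> 4 * k\<close>, \<open>fejer_far\<close> controls the
  tail. For smaller \<open>\<bar>t\<bar>\<close>,
  \<open>1 + t\<^sup>2 \<le> 17 * k\<^sup>2 \<le> 17 * exp (2 * k)\<close> and the kernel is at most
  \<open>exp (4 * k)\<close>; the product explains both 17 and \<open>exp 6\<close>.\<close>

lemma decay_kernel_fejer: "decay_kernel (17 * exp 6 ^ k) (fejer k)"
  unfolding decay_kernel_def
proof (intro conjI allI)
  show "continuous_on UNIV (fejer k)"
    by (meson DERIV_isCont continuous_at_imp_continuous_on has_real_derivative_fejer)
  fix t :: real
  have "(1 + t\<^sup>2) * \<bar>fejer k t\<bar> \<le> 17 * exp 6 ^ k"
  proof (cases "4 * real k \<le> \<bar>t\<bar>")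
    case True
    have "\<bar>fejer k t\<bar> \<le> 8"
    proof (cases "\<bar>t\<bar> \<ge> 1")
      case True
      then have "1 * \<bar>fejer k t\<bar> \<le> t\<^sup>2 * \<bar>fejer k t\<bar>"
        by (intro mult_right_mono) (auto simp: abs_square_le_1 power2_ge_1_iff)
      then show ?thesis using fejer_far[OF \<open>4 * real k \<le> \<bar>t\<bar>\<close>] by simp
    next
      case False
      then have "exp \<bar>t\<bar> \<le> exp 1" by simp
      with abs_fejer_le_exp[of k t] exp_le show ?thesis by linarith
    qed
    with fejer_far[OF True] have "(1 + t\<^sup>2) * \<bar>fejer k t\<bar> \<le> 17 * 1"
      by (simp add: algebra_simps)
    also have "\<dots> \<le> 17 * exp 6 ^ k"
      by (intro mult_left_mono one_le_power) auto
    finally show ?thesis .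
  next
    case False
    have "t\<^sup>2 \<le> (4 * real k)\<^sup>2"
      using False by (intro abs_le_square_iff[THEN iffD1]) auto
    \<comment> \<open>The case \<open>k = 0\<close> belongs to the far region, so here
      \<open>k \<ge> 1\<close>.\<close>
    moreover have "1 \<le> (real k)\<^sup>2"
      using False by (intro one_le_power) auto
    ultimately have "1 + t\<^sup>2 \<le> 17 * (real k)\<^sup>2"
      by (simp add: power_mult_distrib)
    also have "real k \<le> exp (real k)"
      using exp_ge_add_one_self[of "real k"] by linarith
    then have "17 * (real k)\<^sup>2 \<le> 17 * (exp (real k))\<^sup>2"
      by (intro mult_left_mono power_mono) auto
    finally have "1 + t\<^sup>2 \<le> 17 * (exp (real k))\<^sup>2" .
    moreover have "\<bar>fejer k t\<bar> \<le> exp (4 * real k)"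
      using abs_fejer_le_exp[of k t] False by (meson exp_le_cancel_iff linear order_trans)
    ultimately have "(1 + t\<^sup>2) * \<bar>fejer k t\<bar> \<le> 17 * (exp (real k))\<^sup>2 * exp (4 * real k)"
      by (intro mult_mono) auto
    also have "\<dots> = 17 * exp (6 * real k)"
      by (simp add: power2_eq_square flip: exp_add)
    also have "\<dots> = 17 * exp 6 ^ k"
      by (simp add: exp_of_nat2_mult)
    finally show ?thesis .
  qed
  moreover have "1 + t\<^sup>2 > 0"
    by (simp add: add_pos_nonneg)
  ultimately show "\<bar>fejer k t\<bar> \<le> 17 * exp 6 ^ k * inverse (1 + t\<^sup>2)"
    by (simp add: field_simps)
qed

lemma fejer_0_0: "fejer 0 0 = 1 / 2"
  using powser_zero[of "\<lambda>n. fejer_coeff (n + 0) / fact n"]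
  by (simp add: fejer_def) (simp add: fejer_coeff_def)

lemma fejer_0_nonneg: "fejer 0 t \<ge> 0"
proof (cases "t = 0")
  case True
  then show ?thesis
    by (simp add: fejer_0_0)
next
  case False
  have "0 \<le> t\<^sup>2 * fejer 0 t"
    unfolding fejer_0 using cos_le_one[of t] by linarith
  then show ?thesis
    using False by (simp add: zero_le_mult_iff)
qed

lemma fejer_0_integral:
  "fejer 0 integrable_on UNIV" "integral UNIV (fejer 0) > 0"
proof -
  show int: "fejer 0 integrable_on UNIV"
    using decay_kernel_integrable(1)[OF decay_kernel_fejer[of 0], of "\<lambda>_. 1::real" 1] by simp
  have cont: "continuous_on {0..1} (fejer 0)"
    using decay_kernel_fejer[of 0] by (auto simp: decay_kernel_def intro: continuous_on_subset)
  \<comment> \<open>A continuous nonnegative function with zero integral would vanish on the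
    interval, against the value \<open>1 / 2\<close> at 0.\<close>
  have "integral {0..1} (fejer 0) \<noteq> 0"
    using integral_eq_0_iff[OF cont] fejer_0_nonneg fejer_0_0 by force
  moreover have "integral {0..1} (fejer 0) \<ge> 0"
    by (intro integral_nonneg integrable_continuous_real cont fejer_0_nonneg)
  moreover have "integral {0..1} (fejer 0) \<le> integral UNIV (fejer 0)"
    by (intro integral_subset_le integrable_continuous_real cont int)
       (auto simp: fejer_0_nonneg)
  ultimately show "integral UNIV (fejer 0) > 0" by linarith
qed

section \<open>Orbit averages and the action of the generator\<close>

context isometry_group
begin

lemma bounded_linear_T: "bounded_linear (T t)"
proof (rule bounded_linear_intro[where K = 1])
  interpret L: Vector_Spaces.linear scaleC scaleC "T t" by (rule linear)
  show "T t (x + y) = T t x + T t y" for x y by (rule L.add)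
  show "T t (r *\<^sub>R x) = r *\<^sub>R T t x" for r x
    by (metis L.scale scaleC_of_real)
  show "norm (T t x) \<le> norm x * 1" for x by (simp add: isometry)
qed

lemma continuous_on_orbit: "continuous_on S (\<lambda>u. T (a * u) f)"
  by (rule continuous_on_compose2[OF strongly_continuous]) (auto intro: continuous_intros)

text \<open>Left unnormalised, so that it is linear in \<open>\<phi>\<close>; the mass of
  \<open>fejer 0\<close> is divided out only in the final theorem.\<close>

definition average :: "real \<Rightarrow> 'a \<Rightarrow> (real \<Rightarrow> real) \<Rightarrow> 'a" where
  "average \<epsilon> f \<phi> = integral UNIV (\<lambda>u. \<phi> u *\<^sub>R T (\<epsilon> * u) f)"

lemma average_integrable:
  assumes "decay_kernel C \<phi>"
  shows "(\<lambda>u. \<phi> u *\<^sub>R T (\<epsilon> * u) f) integrable_on UNIV"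
  by (rule decay_kernel_integrable(1)[OF assms continuous_on_orbit, where M = "norm f"])
     (simp add: isometry)

lemma norm_average_le:
  assumes "decay_kernel C \<phi>"
  shows "norm (average \<epsilon> f \<phi>) \<le> C * norm f * integral UNIV (\<lambda>u::real. inverse (1 + u\<^sup>2))"
  unfolding average_def
  by (rule decay_kernel_integrable(2)[OF assms continuous_on_orbit]) (simp add: isometry)

text \<open>The group law turns the action of \<open>T\<close> into a translation of the kernel, so
  smoothness in time comes from \<open>\<phi>\<close> and not from \<open>f\<close>.\<close>

lemma T_average:
  assumes "decay_kernel C \<phi>"
  shows "((\<lambda>u. \<phi> (u - s) *\<^sub>R T (\<epsilon> * u) f) has_integral T (\<epsilon> * s) (average \<epsilon> f \<phi>)) UNIV"
proof -
  have "((\<lambda>u. \<phi> u *\<^sub>R T (\<epsilon> * u) f) has_integral average \<epsilon> f \<phi>) UNIV"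
    unfolding average_def by (intro integrable_integral average_integrable[OF assms])
  from has_integral_linear[OF this bounded_linear_T[of "\<epsilon> * s"]]
  have "((\<lambda>u. \<phi> u *\<^sub>R T (\<epsilon> * (s + u)) f) has_integral T (\<epsilon> * s) (average \<epsilon> f \<phi>)) UNIV"
    by (simp add: o_def linear_simps(5)[OF bounded_linear_T] distrib_left add)
  from has_integral_UNIV_shift[OF this, of "- s"] show ?thesis
    by (simp add: algebra_simps)
qed

text \<open>Differentiation falls on the translated kernel: the shift \<open>u - s\<close> gives the
  minus sign, the substitution \<open>t = \<epsilon> * s\<close> the factor
  \<open>1 / \<epsilon>\<close>. The scalar \<open>c\<close> gives input and output the same shape,
  ready for iteration.\<close>

lemma generator_average:
  assumes \<epsilon>: "\<epsilon> > 0"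
    and d0: "\<And>t. (\<phi> has_real_derivative \<phi>' t) (at t)"
    and d1: "\<And>t. (\<phi>' has_real_derivative \<phi>'' t) (at t)"
    and k0: "decay_kernel C0 \<phi>" and k1: "decay_kernel C1 \<phi>'" and k2: "decay_kernel C2 \<phi>''"
  shows "generator T (c *\<^sub>R average \<epsilon> f \<phi>) = Some ((- c / \<epsilon>) *\<^sub>R average \<epsilon> f \<phi>')"
proof -
  define A where "A = average \<epsilon> f \<phi>"
  define A' where "A' = average \<epsilon> f \<phi>'"
  define K where "K = 3 * C2 * norm f * integral UNIV (\<lambda>u::real. inverse (1 + u\<^sup>2))"
  have main: "norm (T (\<epsilon> * s) A - A + s *\<^sub>R A') \<le> s\<^sup>2 * K" if s: "\<bar>s\<bar> \<le> 1" for s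
  proof -
    \<comment> \<open>This is the Taylor remainder of the kernel for the increment
      \<open>- s\<close>; its average is the error to be estimated.\<close>
    define \<psi> where "\<psi> u = \<phi> (u - s) - \<phi> u + s * \<phi>' u" for u
    have "decay_kernel (3 * C2 * s\<^sup>2) \<psi>"
      unfolding decay_kernel_def
    proof (intro conjI allI)
      show "continuous_on UNIV \<psi>"
      proof -
        have "continuous_on UNIV \<phi>" "continuous_on UNIV \<phi>'"
          using k0 k1 by (auto simp: decay_kernel_def)
        moreover from this(1) have "continuous_on UNIV (\<lambda>u. \<phi> (u - s))"
          by (rule continuous_on_compose2) (auto intro: continuous_intros)
        ultimately show ?thesis
          unfolding \<psi>_def by (intro continuous_on_add continuous_on_diff continuous_on_mult_left)
      qed
      show "\<bar>\<psi> u\<bar> \<le> 3 * C2 * s\<^sup>2 * inverse (1 + u\<^sup>2)" for u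
        using decay_kernel_taylor[OF d0 d1 k2, of "- s" u] s by (simp add: \<psi>_def)
    qed
    then have "norm (average \<epsilon> f \<psi>) \<le> s\<^sup>2 * K"
      using norm_average_le[of _ \<psi> \<epsilon> f] by (fastforce simp: K_def mult_ac)
    moreover have "((\<lambda>u. \<phi> (u - s) *\<^sub>R T (\<epsilon> * u) f - \<phi> u *\<^sub>R T (\<epsilon> * u) f
        + s *\<^sub>R (\<phi>' u *\<^sub>R T (\<epsilon> * u) f)) has_integral (T (\<epsilon> * s) A - A + s *\<^sub>R A')) UNIV"
      unfolding A_def A'_def using T_average[OF k0]
      by (intro has_integral_add has_integral_diff has_integral_cmul)
         (auto simp: average_def intro!: integrable_integral average_integrable k0 k1)
    then have "average \<epsilon> f \<psi> = T (\<epsilon> * s) A - A + s *\<^sub>R A'"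
      unfolding average_def \<psi>_def by (intro integral_unique) (simp add: algebra_simps)
    ultimately show ?thesis by simp
  qed
  have "((\<lambda>t. (T t A - A) /\<^sub>R t + (1 / \<epsilon>) *\<^sub>R A') \<longlongrightarrow> 0) (at 0)"
  proof (rule tendsto_norm_zero_cancel, rule tendsto_sandwich)
    show "\<forall>\<^sub>F t in at 0. 0 \<le> norm ((T t A - A) /\<^sub>R t + (1 / \<epsilon>) *\<^sub>R A')" by simp
    show "\<forall>\<^sub>F t in at 0. norm ((T t A - A) /\<^sub>R t + (1 / \<epsilon>) *\<^sub>R A') \<le> \<bar>t\<bar> * K / \<epsilon>\<^sup>2"
      unfolding eventually_at
    \<comment> \<open>The radius \<open>\<epsilon>\<close> makes \<open>s = t / \<epsilon>\<close>
      admissible in \<open>main\<close>.\<close>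
    proof (intro exI[of _ \<epsilon>] conjI ballI impI \<epsilon>)
      fix t :: real
      assume t: "t \<noteq> 0 \<and> dist t 0 < \<epsilon>"
      then have "norm (T t A - A + (t / \<epsilon>) *\<^sub>R A') \<le> (t / \<epsilon>)\<^sup>2 * K"
        using main[of "t / \<epsilon>"] \<epsilon> by simp
      then have "inverse \<bar>t\<bar> * norm (T t A - A + (t / \<epsilon>) *\<^sub>R A') \<le> inverse \<bar>t\<bar> * ((t / \<epsilon>)\<^sup>2 * K)"
        by (intro mult_left_mono) auto
      also have "inverse \<bar>t\<bar> * ((t / \<epsilon>)\<^sup>2 * K) = \<bar>t\<bar> * K / \<epsilon>\<^sup>2"
      proof -
        have "inverse r * (r\<^sup>2 / \<epsilon>\<^sup>2 * K) = r * K / \<epsilon>\<^sup>2" if "r > 0" for r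
          using that by (simp add: power2_eq_square)
        from this[of "\<bar>t\<bar>"] t \<epsilon> show ?thesis by (simp add: power_divide)
      qed
      also have "inverse \<bar>t\<bar> * norm (T t A - A + (t / \<epsilon>) *\<^sub>R A')
          = norm (inverse t *\<^sub>R (T t A - A + (t / \<epsilon>) *\<^sub>R A'))"
        by simp
      also have "inverse t *\<^sub>R (T t A - A + (t / \<epsilon>) *\<^sub>R A') = (T t A - A) /\<^sub>R t + (1 / \<epsilon>) *\<^sub>R A'"
        using t by (simp add: scaleR_add_right field_simps)
      finally show "norm ((T t A - A) /\<^sub>R t + (1 / \<epsilon>) *\<^sub>R A') \<le> \<bar>t\<bar> * K / \<epsilon>\<^sup>2" .
    qed
    show "((\<lambda>t. \<bar>t\<bar> * K / \<epsilon>\<^sup>2) \<longlongrightarrow> 0) (at 0)"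
      using \<epsilon> by (auto intro!: tendsto_eq_intros)
  qed auto
  from tendsto_scaleR[OF tendsto_const[of c] tendsto_diff[OF this tendsto_const[of "(1 / \<epsilon>) *\<^sub>R A'"]]]
  have "((\<lambda>t. c *\<^sub>R ((T t A - A) /\<^sub>R t)) \<longlongrightarrow> (- c / \<epsilon>) *\<^sub>R A') (at 0)"
    by simp
  moreover have "c *\<^sub>R ((T t A - A) /\<^sub>R t) = (T t (c *\<^sub>R A) - c *\<^sub>R A) /\<^sub>R t" for t
    by (simp add: linear_simps(5)[OF bounded_linear_T] algebra_simps)
  ultimately show ?thesis
    unfolding generator_eq_Some_iff A_def[symmetric] A'_def[symmetric] by simp
qed

lemma op_power_generator_average_fejer:
  assumes "\<epsilon> > 0"
  shows "op_power (generator T) k (c *\<^sub>R average \<epsilon> f (fejer 0))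
           = Some ((c * (- 1 / \<epsilon>) ^ k) *\<^sub>R average \<epsilon> f (fejer k))"
proof (induction k)
  case (Suc k)
  show ?case
    using generator_average[OF assms has_real_derivative_fejer has_real_derivative_fejer
        decay_kernel_fejer decay_kernel_fejer decay_kernel_fejer, of "c * (- 1 / \<epsilon>) ^ k" f k]
    by (simp add: Suc.IH map_comp_def)
qed simp

text \<open>An approximate identity argument. Dominated convergence is applied to the real functions
  \<open>?F n\<close>, with a majorant supplied by the isometry property; their integrals then bound
  the vector error.\<close>

lemma average_fejer_tendsto:
  "(\<lambda>n. average (inverse (real (Suc n))) f (fejer 0)) \<longlonglongrightarrow> integral UNIV (fejer 0) *\<^sub>R f"
proof -
  let ?\<epsilon> = "\<lambda>n. inverse (real (Suc n))"
  let ?F = "\<lambda>n u. fejer 0 u *\<^sub>R norm (T (?\<epsilon> n * u) f - f)"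
  have cont: "continuous_on UNIV (\<lambda>u. norm (T (?\<epsilon> n * u) f - f))" for n
    by (intro continuous_intros continuous_on_orbit)
  have le: "norm (T t f - f) \<le> 2 * norm f" for t
    using norm_triangle_ineq4[of "T t f" f] by (simp add: isometry)
  have int: "?F n integrable_on UNIV" for n
    by (rule decay_kernel_integrable(1)[OF decay_kernel_fejer cont, where M = "2 * norm f"])
       (simp add: le)
  have "(\<lambda>n. integral UNIV (?F n)) \<longlonglongrightarrow> integral UNIV (\<lambda>_::real. 0::real)"
  proof (rule dominated_convergence(2)[where h = "\<lambda>u. 2 * norm f * fejer 0 u"])
    show "(\<lambda>u. 2 * norm f * fejer 0 u) integrable_on UNIV"
      using integrable_on_cmult_left[OF fejer_0_integral(1), of "2 * norm f"] by simp
    show "norm (?F n u) \<le> 2 * norm f * fejer 0 u" for n u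
      using mult_left_mono[OF le fejer_0_nonneg[of u]]
      by (simp add: fejer_0_nonneg abs_mult mult_ac)
    show "(\<lambda>n. ?F n u) \<longlonglongrightarrow> 0" for u
    proof -
      have "(\<lambda>n. ?\<epsilon> n * u) \<longlonglongrightarrow> 0"
        using tendsto_mult_left_zero[OF LIMSEQ_inverse_real_of_nat] by simp
      moreover have "isCont (\<lambda>t. T t f) 0"
        using strongly_continuous by (simp add: continuous_on_eq_continuous_at)
      ultimately have "(\<lambda>n. T (?\<epsilon> n * u) f) \<longlonglongrightarrow> T 0 f"
        by (rule isCont_tendsto_compose[rotated])
      then have "(\<lambda>n. ?F n u) \<longlonglongrightarrow> fejer 0 u *\<^sub>R norm (T 0 f - f)"
        by (intro tendsto_intros)
      then show ?thesis by (simp add: zero)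
    qed
  qed (rule int)
  then have lim: "(\<lambda>n. integral UNIV (?F n)) \<longlonglongrightarrow> 0" by simp
  have "norm (average (?\<epsilon> n) f (fejer 0) - integral UNIV (fejer 0) *\<^sub>R f) \<le> integral UNIV (?F n)" for n
  proof -
    have "((\<lambda>u. fejer 0 u *\<^sub>R T (?\<epsilon> n * u) f - fejer 0 u *\<^sub>R f) has_integral
        average (?\<epsilon> n) f (fejer 0) - integral UNIV (fejer 0) *\<^sub>R f) UNIV"
      unfolding average_def
      by (intro has_integral_diff has_integral_scaleR_left integrable_integral
          average_integrable[OF decay_kernel_fejer] fejer_0_integral)
    then have *: "((\<lambda>u. fejer 0 u *\<^sub>R (T (?\<epsilon> n * u) f - f)) has_integral
        average (?\<epsilon> n) f (fejer 0) - integral UNIV (fejer 0) *\<^sub>R f) UNIV"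
      by (simp add: scaleR_diff_right)
    have "norm (integral UNIV (\<lambda>u. fejer 0 u *\<^sub>R (T (?\<epsilon> n * u) f - f))) \<le> integral UNIV (?F n)"
      by (rule integral_norm_bound_integral[OF has_integral_integrable[OF *] int])
         (simp add: fejer_0_nonneg)
    then show ?thesis unfolding integral_unique[OF *] .
  qed
  then have "(\<lambda>n. average (?\<epsilon> n) f (fejer 0) - integral UNIV (fejer 0) *\<^sub>R f) \<longlonglongrightarrow> 0"
    by (intro Lim_null_comparison[OF _ lim] always_eventually allI)
  then show ?thesis by (rule LIM_zero_cancel)
qed

end

section \<open>Membership in Bernstein subspaces and density\<close>

text \<open>The constant \<open>C\<close> is absorbed by enlarging the exponential type, so no sharp Bernstein inequality is
  needed.\<close>

lemma exponential_type_imp_Bernstein: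
  assumes D0: "D 0 = Some 0"
    and val: "\<And>k. op_power D k g = Some (y k)"
    and bound: "\<And>k. norm (y k) \<le> C * s ^ k" and s: "s \<ge> 0"
  shows "\<exists>\<sigma>\<ge>0. g \<in> Bernstein_space D \<sigma>"
proof -
  have y0: "y 0 = g" using val[of 0] by simp
  have smooth: "g \<in> smooth_domain D"
    using val by (auto simp: smooth_domain_def)
  show ?thesis
  proof (cases "g = 0")
    case True
    have "op_power D k g = Some 0" for k
      using True D0 by (induction k) (simp_all add: map_comp_def)
    then show ?thesis
      using smooth by (auto simp: Bernstein_space_def)
  next
    case False
    \<comment> \<open>Since \<open>q \<ge> 1\<close>, \<open>q ^ k \<ge> q \<ge> C / norm g\<close>
      for all \<open>k \<ge> 1\<close>, so one factor \<open>q\<close> per derivative pays for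
      \<open>C\<close>.\<close>
    define q where "q = max 1 (C / norm g)"
    have "norm (y k) \<le> (s * q) ^ k * norm g" if "k \<ge> 1" for k
    proof -
      have "C / norm g \<le> q" "q \<ge> 1" by (simp_all add: q_def)
      moreover have "q \<le> q ^ k"
        using \<open>q \<ge> 1\<close> that by (simp add: self_le_power)
      ultimately have "C / norm g \<le> q ^ k" by linarith
      then have "C \<le> q ^ k * norm g"
        using False by (simp add: divide_le_eq)
      then have "C * s ^ k \<le> (q ^ k * norm g) * s ^ k"
        using s by (intro mult_right_mono) auto
      with bound[of k] show ?thesis by (simp add: power_mult_distrib mult_ac)
    qed
    moreover have "s * q \<ge> 0" using s by (simp add: q_def)
    ultimately show ?thesis
      using smooth val by (auto simp: Bernstein_space_def)
  qed
qed

theorem theorem7p5: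
  fixes D :: "'a :: complex_banach \<rightharpoonup> 'a" and T :: "real \<Rightarrow> 'a \<Rightarrow> 'a"
  assumes "isometry_group T" and "D = generator T"
  shows "closure (\<Union>\<sigma>\<in>{0..}. Bernstein_space D \<sigma>) = UNIV"
proof -
  interpret isometry_group T by fact
  have "T t 0 = 0" for t
    using isometry[of t 0] by simp
  then have D0: "D 0 = Some 0"
    unfolding assms(2) generator_eq_Some_iff by simp
  have "f \<in> closure (\<Union>\<sigma>\<in>{0..}. Bernstein_space D \<sigma>)" for f
  proof -
    \<comment> \<open>Normalises the kernel to mass 1, so that the averages tend to \<open>f\<close>
      itself.\<close>
    define c where "c = inverse (integral UNIV (fejer 0))"
    define W where "W = integral UNIV (\<lambda>u::real. inverse (1 + u\<^sup>2))"
    define g where "g n = c *\<^sub>R average (inverse (real (Suc n))) f (fejer 0)" for n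
    have "c *\<^sub>R integral UNIV (fejer 0) *\<^sub>R f = f"
      using fejer_0_integral(2) by (simp add: c_def)
    then have "g \<longlonglongrightarrow> f"
      using tendsto_scaleR[OF tendsto_const[of c] average_fejer_tendsto[of f]]
      unfolding g_def by simp
    moreover have "g n \<in> (\<Union>\<sigma>\<in>{0..}. Bernstein_space D \<sigma>)" for n
    proof -
      define \<epsilon> where "\<epsilon> = inverse (real (Suc n))"
      have \<epsilon>: "\<epsilon> > 0" by (simp add: \<epsilon>_def)
      have val: "op_power D k (g n) = Some ((c * (- 1 / \<epsilon>) ^ k) *\<^sub>R average \<epsilon> f (fejer k))" for k
        unfolding assms(2) g_def \<epsilon>_def[symmetric]
        by (rule op_power_generator_average_fejer[OF \<epsilon>])
      \<comment> \<open>The rate \<open>exp 6 / \<epsilon>\<close> grows with \<open>n\<close>,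
        which is harmless: each \<open>g n\<close> only has to lie in some Bernstein
        subspace.\<close>
      have "norm ((c * (- 1 / \<epsilon>) ^ k) *\<^sub>R average \<epsilon> f (fejer k))
          \<le> (\<bar>c\<bar> * 17 * norm f * W) * (exp 6 / \<epsilon>) ^ k" for k
      proof -
        have "norm ((c * (- 1 / \<epsilon>) ^ k) *\<^sub>R average \<epsilon> f (fejer k))
            = (\<bar>c\<bar> * (1 / \<epsilon>) ^ k) * norm (average \<epsilon> f (fejer k))"
          using \<epsilon> by (simp add: abs_mult power_abs)
        also have "\<dots> \<le> (\<bar>c\<bar> * (1 / \<epsilon>) ^ k) * (17 * exp 6 ^ k * norm f * W)"
          unfolding W_def using \<epsilon> by (intro mult_left_mono norm_average_le decay_kernel_fejer) auto
        finally show ?thesis by (simp add: power_divide mult_ac)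
      qed
      from exponential_type_imp_Bernstein[OF D0 val this] \<epsilon> show ?thesis by auto
    qed
    ultimately show ?thesis
      unfolding closure_sequential by blast
  qed
  then show ?thesis by blast
qed

end
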